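(* Let $H$ be a finite-dimensional Hilbert space, let $A$ and $B$ be (constant) linear operators on $H$ with $A > 0$ and $B = B^* \ge 0$. Let $\sigma_A > 0$, $\sigma_B > 0$ be constants satisfying $$\sigma_A^2 \ge \frac12, \qquad \sigma_B \ge \frac12 .$$ For $\tau > 0$ put $$\widetilde{A^*A} = (I + \sigma_A\tau A^* )^{-1} A^* A (I + \sigma_A \tau A)^{-1}, \qquad \widetilde{B} = (I + \sigma_B\tau^2 B)^{-1}B .$$ Then the regularized scheme $$\frac{u^{n+1} - 2u^n + u^{n-1}}{\tau^2} + \widetilde{A^*A}\,u^n + \widetilde{B}\,u^n = 0, \qquad n = 1,\dots,N-1,$$ with given initial data $u^0 = w^0 \in H$, $u^1 = \overline{w}^1 \in H$, is unconditionally stable. Namely, for every $\tau>0$, with $$D = \widetilde{A^*A} + \widetilde{B}, \qquad G = I - \frac{\tau^2}{4} D,$$ one has $G \ge 0$, and the solution of the scheme satisfies, for all $n = 1,\dots,N-1$, $$\left\| \frac{u^{n+1}-u^n}{\tau} \right\|_G^2 + \left\| \frac{u^{n+1}+u^n}{2} \right\|_D^2 = \left\| \frac{\overline{w}^1-w^0}{\tau} \right\|_G^2 + \left\| \frac{\overline{w}^1+w^0}{2} \right\|_D^2 .$$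
   Context: $H$ is a finite-dimensional Hilbert space (over $\mathbb{R}$ or $\mathbb{C}$) with scalar product $(u,v)$ and norm $\|u\| = (u,u)^{1/2}$; $I$ is the identity operator and $A^*$ denotes the adjoint of $A$. For an operator $S$ on $H$, $S \ge 0$ means $(Su,u) \ge 0$ for all $u \in H$, and $S > 0$ means $(Su,u) > 0$ for all $u \ne 0$ (over $\mathbb{R}$, self-adjointness of $S$ is not implied, and $A$ need not be self-adjoint). For a self-adjoint non-negative operator $S$, $\|u\|_S^2 = (Su,u)$. The scheme is a time discretization on the uniform grid $t^n = n\tau$, $n = 0,\dots,N$, $N\tau = T$, with step $\tau>0$, of the Cauchy problem $\frac{d^2 w}{dt^2} + A^*A w + Bw = 0$, $0 < t \le T$, and $u^n \in H$ is the approximate solution at $t^n$. A three-level scheme $C\frac{u^{n+1}-2u^n+u^{n-1}}{\tau^2} + D u^n = 0$ with self-adjoint $C$, $D$ is called stable here when $G = C - \frac{\tau^2}{4}D \ge 0$, $D \ge 0$ and the displayed a priori equality holds; "unconditionally stable" means that this holds with no restriction on the time step $\tau$. *)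

theory Defs
  imports Complex_Main "Jordan_Normal_Form.Conjugate"
begin

(* The scalar fields of a Hilbert space. A commutative normed field over the reals is
   isomorphic to the reals or to the complex numbers, and the two axioms fix the conjugation
   and the order: z >= 0 means that z is a non-negative real number. *)
class hilbert_scalar = real_normed_field + conjugatable_ordered_field +
  assumes mult_conjugate: "x * conjugate x = (norm x)\<^sup>2 *\<^sub>R 1"
    and nonneg_iff_scaleR: "0 \<le> x \<longleftrightarrow> (\<exists>r\<ge>0. x = r *\<^sub>R 1)"

instance real :: hilbert_scalar
  by intro_classes (auto simp: power2_eq_square)

instance complex :: hilbert_scalar
proof
  fix x :: complex
  show "x * conjugate x = (norm x)\<^sup>2 *\<^sub>R 1"
    by (simp add: complex_norm_square[symmetric] scaleR_conv_of_real del: of_real_power)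
  show "0 \<le> x \<longleftrightarrow> (\<exists>r\<ge>0. x = r *\<^sub>R 1)"
    by (auto simp: less_eq_complex_def complex_eq_iff)
qed

(* Completeness is automatic in finite dimension. *)
locale fd_hilbert = vector_space scale
  for scale :: "'k::hilbert_scalar \<Rightarrow> 'v::ab_group_add \<Rightarrow> 'v" +
  fixes ip :: "'v \<Rightarrow> 'v \<Rightarrow> 'k"
  assumes finite_dimension: "\<exists>S. finite S \<and> span S = UNIV"
    and ip_add_left: "ip (u + v) w = ip u w + ip v w"
    and ip_scale_left: "ip (scale c u) v = c * ip u v"
    and ip_conjugate: "ip u v = conjugate (ip v u)"
    and ip_pos: "u \<noteq> 0 \<Longrightarrow> 0 < ip u u"

(* Analogue of the library's adjoint, which is restricted to real inner product spaces. *)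
definition adj :: "('v \<Rightarrow> 'v \<Rightarrow> 'k) \<Rightarrow> ('v \<Rightarrow> 'v) \<Rightarrow> 'v \<Rightarrow> 'v" where
  "adj ip A = (SOME A'. \<forall>u v. ip (A u) v = ip u (A' v))"

(* Over the complex numbers the inequalities include that ip (S u) u is real. *)
definition nonneg_op :: "('v \<Rightarrow> 'v \<Rightarrow> 'k::hilbert_scalar) \<Rightarrow> ('v \<Rightarrow> 'v) \<Rightarrow> bool" where
  "nonneg_op ip S \<longleftrightarrow> (\<forall>u. 0 \<le> ip (S u) u)"

definition pos_op :: "('v::zero \<Rightarrow> 'v \<Rightarrow> 'k::hilbert_scalar) \<Rightarrow> ('v \<Rightarrow> 'v) \<Rightarrow> bool" where
  "pos_op ip S \<longleftrightarrow> (\<forall>u. u \<noteq> 0 \<longrightarrow> 0 < ip (S u) u)"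

(* The squared S-seminorm, meant for S self-adjoint and non-negative; it is then
   a non-negative real number, regarded as an element of the scalar field. *)
definition sqnorm_op :: "('v \<Rightarrow> 'v \<Rightarrow> 'k) \<Rightarrow> ('v \<Rightarrow> 'v) \<Rightarrow> 'v \<Rightarrow> 'k" where
  "sqnorm_op ip S u = ip (S u) u"

definition shift_op :: "('k::hilbert_scalar \<Rightarrow> 'v::ab_group_add \<Rightarrow> 'v) \<Rightarrow> real \<Rightarrow> ('v \<Rightarrow> 'v) \<Rightarrow> 'v \<Rightarrow> 'v" where
  "shift_op scale c S u = u + scale (of_real c) (S u)"

definition reg_AstarA ::
  "('k::hilbert_scalar \<Rightarrow> 'v::ab_group_add \<Rightarrow> 'v) \<Rightarrow> ('v \<Rightarrow> 'v \<Rightarrow> 'k) \<Rightarrow> real \<Rightarrow> real \<Rightarrow> ('v \<Rightarrow> 'v) \<Rightarrow> 'v \<Rightarrow> 'v" where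
  "reg_AstarA scale ip \<sigma> \<tau> A =
     inv (shift_op scale (\<sigma> * \<tau>) (adj ip A)) \<circ> adj ip A \<circ> A \<circ> inv (shift_op scale (\<sigma> * \<tau>) A)"

definition reg_B ::
  "('k::hilbert_scalar \<Rightarrow> 'v::ab_group_add \<Rightarrow> 'v) \<Rightarrow> real \<Rightarrow> real \<Rightarrow> ('v \<Rightarrow> 'v) \<Rightarrow> 'v \<Rightarrow> 'v" where
  "reg_B scale \<sigma> \<tau> B = inv (shift_op scale (\<sigma> * \<tau>\<^sup>2) B) \<circ> B"

end

theory Submission
  imports Defs
begin

text \<open>
  Write \<open>c = \<sigma>A \<tau>\<close> and \<open>d = \<sigma>B \<tau>\<^sup>2\<close>. With \<open>R = (I + c A)\<^sup>-\<^sup>1\<close> the regularized operators are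
  \<open>(A R)\<^sup>* (A R)\<close> and \<open>(I + d B)\<^sup>-\<^sup>1 B\<close>, hence self-adjoint and non-negative. Substituting
  \<open>v = w + c A w\<close>, respectively \<open>v = w + d B w\<close>, shows that the quadratic form of either one,
  multiplied by \<open>\<tau>\<^sup>2 / 2\<close>, is at most \<open>(v, v)\<close>, because \<open>\<tau>\<^sup>2 / 2 \<le> c\<^sup>2\<close> and \<open>\<tau>\<^sup>2 / 2 \<le> d\<close>; the
  average of the two bounds is \<open>G \<ge> 0\<close>. The energy of a pair \<open>(x, y)\<close> of consecutive values equals
  \<open>(x - y, x - y) / \<tau>\<^sup>2 + ((D x, y) + (D y, x)) / 2\<close>, and the scheme makes it independent of the
  time level.
\<close>

section \<open>Scalars\<close>

lemma hilbert_scalar_nonneg_iff: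
  fixes x :: "'k::hilbert_scalar"
  shows "0 \<le> x \<longleftrightarrow> (\<exists>r\<ge>0. x = of_real r)"
  unfolding of_real_def by (rule nonneg_iff_scaleR)

lemma of_real_nonneg: "0 \<le> r \<Longrightarrow> 0 \<le> (of_real r :: 'k::hilbert_scalar)"
  using hilbert_scalar_nonneg_iff by blast

text \<open>For x = r with r real, \<open>mult_conjugate\<close> reads x * conjugate x = x * x, and
  x cancels. This later replaces symmetry of A in quadratic forms.\<close>

lemma conjugate_nonneg:
  fixes x :: "'k::hilbert_scalar"
  assumes "0 \<le> x"
  shows "conjugate x = x"
proof (cases "x = 0")
  case False
  obtain r where r: "r \<ge> 0" "x = of_real r"
    using assms hilbert_scalar_nonneg_iff by blast
  have "x * conjugate x = x * x"
    using mult_conjugate[of x] r by (simp add: power2_eq_square of_real_def)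
  with False show ?thesis by simp
qed simp

lemma conjugate_of_real:
  "conjugate (of_real r :: 'k::hilbert_scalar) = of_real r"
proof (cases "r \<ge> 0")
  case True
  then show ?thesis by (intro conjugate_nonneg of_real_nonneg)
next
  case False
  then have "conjugate (of_real (- r) :: 'k) = of_real (- r)"
    by (intro conjugate_nonneg of_real_nonneg) simp
  then show ?thesis by (simp add: conjugate_neg)
qed

lemma of_real_mult_nonneg:
  fixes x :: "'k::hilbert_scalar"
  assumes "0 \<le> r" "0 \<le> x"
  shows "0 \<le> of_real r * x"
proof -
  obtain s where "s \<ge> 0" "x = of_real s"
    using assms(2) hilbert_scalar_nonneg_iff by blast
  then show ?thesis
    using of_real_nonneg[of "r * s"] assms(1) by simp
qed

section \<open>Adjoints and inverses in finite dimension\<close>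

context fd_hilbert
begin

section \<open>Sesquilinearity and nondegeneracy of the scalar product\<close>

lemma ip_add_right: "ip u (v + w) = ip u v + ip u w"
  by (metis ip_add_left ip_conjugate conjugate_dist_add)

lemma ip_scale_right: "ip u (scale c v) = conjugate c * ip u v"
  by (metis ip_scale_left ip_conjugate conjugate_dist_mul)

lemma ip_zero_left [simp]: "ip 0 v = 0"
  using ip_add_left[of 0 0 v] by simp

lemma ip_zero_right [simp]: "ip v 0 = 0"
  using ip_add_right[of v 0 0] by simp

lemma ip_minus_left: "ip (- u) v = - ip u v"
  using ip_add_left[of u "- u" v] by (simp add: eq_neg_iff_add_eq_0 add.commute)

lemma ip_minus_right: "ip u (- v) = - ip u v"
  using ip_add_right[of u v "- v"] by (simp add: eq_neg_iff_add_eq_0 add.commute)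

lemma ip_diff_left: "ip (u - v) w = ip u w - ip v w"
  using ip_add_left[of u "- v" w] by (simp add: ip_minus_left)

lemma ip_diff_right: "ip u (v - w) = ip u v - ip u w"
  using ip_add_right[of u v "- w"] by (simp add: ip_minus_right)

lemmas ip_simps =
  ip_add_left ip_add_right ip_diff_left ip_diff_right ip_scale_left ip_scale_right
  ip_minus_left ip_minus_right conjugate_of_real

lemma ip_self_nonneg: "0 \<le> ip u u"
  using ip_pos[of u] by (cases "u = 0") auto

lemma ip_right_cancel:
  assumes "\<And>u. ip u v = ip u w"
  shows "v = w"
proof (rule ccontr)
  assume "v \<noteq> w"
  then have "0 < ip (v - w) (v - w)" by (intro ip_pos) simp
  moreover have "ip (v - w) (v - w) = 0" using assms by (simp add: ip_diff_right)
  ultimately show False by simp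
qed

text \<open>Gram-Schmidt by induction on the spanning set. The projection p of a new generator a
  onto \<open>span S\<close> comes from the induction hypothesis itself, applied to the functional u
  -> (u, a).\<close>

lemma riesz_representation_span:
  assumes "finite S" and "Vector_Spaces.linear scale (*) f"
  shows "\<exists>w\<in>span S. \<forall>u\<in>span S. f u = ip u w"
  using assms
proof (induction S arbitrary: f rule: finite_induct)
  case empty
  interpret f: Vector_Spaces.linear scale "(*)" f by fact
  show ?case by simp
next
  case (insert a S)
  interpret f: Vector_Spaces.linear scale "(*)" f by fact
  obtain w where w: "w \<in> span S" "\<forall>u\<in>span S. f u = ip u w"
    using insert.IH[OF insert.prems] by blast
  have "Vector_Spaces.linear scale (*) (\<lambda>u. ip u a)"
    by unfold_locales (simp_all add: ip_simps algebra_simps)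
  from insert.IH[OF this] obtain p
    where p: "p \<in> span S" "\<forall>u\<in>span S. ip u a = ip u p" by blast
  define b where "b = a - p"
  have b_orth: "ip u b = 0" "ip b u = 0" if "u \<in> span S" for u
  proof -
    show "ip u b = 0" using p that by (simp add: b_def ip_diff_right)
    then show "ip b u = 0" using ip_conjugate[of b u] by simp
  qed
  have sub: "span S \<subseteq> span (insert a S)" by (intro span_mono) auto
  have b_in: "b \<in> span (insert a S)"
    unfolding b_def using p(1) sub by (intro span_diff) (auto intro: span_base)
  show ?case
  proof (cases "b = 0")
    case True
    then have "a \<in> span S" using p(1) by (simp add: b_def)
    then have "span (insert a S) = span S" by (rule span_redundant)
    with w show ?thesis by auto
  next
    case False
    \<comment> \<open>The conjugate compensates conjugate-linearity in the second argument, so that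
      (b, c b) = f b; w does not contribute at b, being orthogonal to it.\<close>
    define c where "c = conjugate (f b / ip b b)"
    have bb: "ip b b \<noteq> 0" using ip_pos[OF False] by auto
    have "f u = ip u (w + scale c b)" if u_in: "u \<in> span (insert a S)" for u
    proof -
      obtain k where k: "u - scale k a \<in> span S"
        using u_in by (auto simp: span_insert)
      \<comment> \<open>Replacing a by b + p moves the p-part into \<open>span S\<close> and leaves
        the orthogonal decomposition u = s + k b.\<close>
      define s where "s = u - scale k a + scale k p"
      have s: "s \<in> span S" unfolding s_def using k p(1) by (intro span_add span_scale)
      have u: "u = s + scale k b" by (simp add: s_def b_def scale_right_diff_distrib)
      show ?thesis
        using s w b_orth[OF s] b_orth[OF w(1)] bb
        by (simp add: u ip_simps f.add f.scale c_def)
    qed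
    moreover have "w + scale c b \<in> span (insert a S)"
      using w(1) sub b_in by (intro span_add span_scale) auto
    ultimately show ?thesis by blast
  qed
qed

lemma riesz_representation:
  assumes "Vector_Spaces.linear scale (*) f"
  shows "\<exists>w. \<forall>u. f u = ip u w"
proof -
  obtain S where "finite S" "span S = UNIV" using finite_dimension by blast
  then show ?thesis using riesz_representation_span[OF _ assms, of S] by auto
qed

text \<open>\<open>adj\<close> is a choice, so it has its defining property only once some adjoint
  exists; Riesz representation of u -> (T u, v), for each v, provides one.\<close>

lemma ip_adj:
  assumes "Vector_Spaces.linear scale scale T"
  shows "ip (T u) v = ip u (adj ip T v)"
proof -
  interpret T: Vector_Spaces.linear scale scale T by fact
  have "\<forall>v. \<exists>w. \<forall>u. ip (T u) v = ip u w"
  proof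
    fix v
    have "Vector_Spaces.linear scale (*) (\<lambda>u. ip (T u) v)"
      by unfold_locales (simp_all add: ip_simps T.add T.scale algebra_simps)
    then show "\<exists>w. \<forall>u. ip (T u) v = ip u w" by (rule riesz_representation)
  qed
  then have "\<exists>T'. \<forall>u v. ip (T u) v = ip u (T' v)" by metis
  then have "\<forall>u v. ip (T u) v = ip u (adj ip T v)" unfolding adj_def by (rule someI_ex)
  then show ?thesis by blast
qed

text \<open>T' witnesses that the choice in \<open>adj\<close> succeeds, and nondegeneracy makes the
  chosen map equal to it.\<close>

lemma adj_eqI:
  assumes "\<And>u v. ip (T u) v = ip u (T' v)"
  shows "adj ip T = T'"
proof
  fix v
  have "\<forall>u v. ip (T u) v = ip u (adj ip T v)"
    unfolding adj_def by (rule someI[where x = T']) (simp add: assms)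
  then show "adj ip T v = T' v"
    using assms by (intro ip_right_cancel) metis
qed

lemma linear_adj:
  assumes "Vector_Spaces.linear scale scale T"
  shows "Vector_Spaces.linear scale scale (adj ip T)"
proof unfold_locales
  show "adj ip T (u + v) = adj ip T u + adj ip T v" for u v
    by (rule ip_right_cancel) (simp add: ip_simps ip_adj[OF assms, symmetric])
  show "adj ip T (scale c v) = scale c (adj ip T v)" for c v
    by (rule ip_right_cancel) (simp add: ip_simps ip_adj[OF assms, symmetric])
qed

text \<open>The form of the adjoint is the conjugate of the form of T, and a non-negative scalar is
  its own conjugate.\<close>

lemma nonneg_op_adj:
  assumes "Vector_Spaces.linear scale scale T" and "nonneg_op ip T"
  shows "nonneg_op ip (adj ip T)"
  unfolding nonneg_op_def
proof
  fix u
  have "ip (adj ip T u) u = conjugate (ip (T u) u)"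
    using ip_conjugate[of "adj ip T u" u] by (simp add: ip_adj[OF assms(1)])
  then show "0 \<le> ip (adj ip T u) u"
    using assms(2) conjugate_nonneg[of "ip (T u) u"] by (simp add: nonneg_op_def)
qed

section \<open>Invertibility of \<open>I + c T\<close> for non-negative T\<close>

lemma linear_inj_imp_bij:
  assumes "Vector_Spaces.linear scale scale T" and "inj T"
  shows "bij T"
proof -
  obtain S where S: "finite S" "span S = UNIV" using finite_dimension by blast
  \<comment> \<open>A basis extracted from the spanning set opens the theory of finite dimension, in
    which injective endomorphisms are surjective.\<close>
  obtain Bs where Bs: "Bs \<subseteq> S" "independent Bs" "S \<subseteq> span Bs"
    using maximal_independent_subset[of S] .
  have "span Bs = UNIV"
    using span_minimal[OF Bs(3) subspace_span] S(2) by auto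
  moreover have "finite Bs" using Bs(1) S(1) by (rule finite_subset)
  ultimately interpret finite_dimensional_vector_space scale Bs
    using Bs(2) by unfold_locales
  show ?thesis using linear_inj_imp_surj[OF assms] assms(2) by (simp add: bij_def)
qed

lemma linear_shift_op:
  assumes "Vector_Spaces.linear scale scale T"
  shows "Vector_Spaces.linear scale scale (shift_op scale c T)"
proof -
  interpret T: Vector_Spaces.linear scale scale T by fact
  show ?thesis
    by unfold_locales
      (simp_all add: shift_op_def T.add T.scale scale_right_distrib scale_left_commute)
qed

text \<open>A nonzero u in the kernel would give 0 = (u, u) + c (T u, u) >= (u, u) > 0.\<close>

lemma bij_shift_op:
  assumes T: "Vector_Spaces.linear scale scale T" and nn: "nonneg_op ip T" and c: "0 \<le> c"
  shows "bij (shift_op scale c T)"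
proof (rule linear_inj_imp_bij[OF linear_shift_op[OF T]])
  interpret L: Vector_Spaces.linear scale scale "shift_op scale c T" by (rule linear_shift_op[OF T])
  have "u = 0" if u: "shift_op scale c T u = 0" for u
  proof (rule ccontr)
    assume "u \<noteq> 0"
    then have "0 < ip u u" by (rule ip_pos)
    also have "ip u u \<le> ip u u + of_real c * ip (T u) u"
      using add_left_mono[OF of_real_mult_nonneg[OF c], of "ip (T u) u" "ip u u"] nn
      by (simp add: nonneg_op_def)
    also have "\<dots> = ip (shift_op scale c T u) u" by (simp add: shift_op_def ip_simps)
    finally show False using u by simp
  qed
  then show "inj (shift_op scale c T)" by (simp add: L.inj_iff_eq_0)
qed

lemma linear_inv:
  assumes "Vector_Spaces.linear scale scale T" and "bij T"
  shows "Vector_Spaces.linear scale scale (inv T)"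
proof -
  interpret T: Vector_Spaces.linear scale scale T by fact
  have [simp]: "T (inv T x) = x" for x using assms(2) by (simp add: bij_is_surj surj_f_inv_f)
  have eqI: "x = y" if "T x = T y" for x y
    by (rule injD[OF bij_is_inj[OF assms(2)] that])
  show ?thesis
    by unfold_locales (rule eqI, simp add: T.add T.scale)+
qed

lemma ip_shift_op_adj:
  assumes "Vector_Spaces.linear scale scale T"
  shows "ip (shift_op scale c T u) v = ip u (shift_op scale c (adj ip T) v)"
  by (simp add: shift_op_def ip_simps ip_adj[OF assms])

section \<open>The regularized operators\<close>

text \<open>The inverse of I + c \<open>adj ip A\<close> is the adjoint of R, the inverse of I + c
  A. In this form symmetry and non-negativity can both be read off.\<close>

lemma ip_reg_AstarA:
  assumes A: "Vector_Spaces.linear scale scale A" and nn: "nonneg_op ip A" and c: "0 \<le> \<sigma> * \<tau>"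
  shows "ip (reg_AstarA scale ip \<sigma> \<tau> A u) v =
    ip (A (inv (shift_op scale (\<sigma> * \<tau>) A) u)) (A (inv (shift_op scale (\<sigma> * \<tau>) A) v))"
proof -
  let ?L = "shift_op scale (\<sigma> * \<tau>) A" and ?M = "shift_op scale (\<sigma> * \<tau>) (adj ip A)"
  have L: "?L (inv ?L x) = x" for x
    using bij_shift_op[OF A nn c] by (simp add: bij_is_surj surj_f_inv_f)
  have M: "?M (inv ?M x) = x" for x
    using bij_shift_op[OF linear_adj[OF A] nonneg_op_adj[OF A nn] c]
    by (simp add: bij_is_surj surj_f_inv_f)
  have adj_left: "ip (adj ip A x) y = ip x (A y)" for x y
    using ip_adj[OF A, of y x] ip_conjugate by metis
  have M_left: "ip (inv ?M x) y = ip x (inv ?L y)" for x y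
    using ip_shift_op_adj[OF A, of "\<sigma> * \<tau>" "inv ?L y" "inv ?M x"] L M ip_conjugate by metis
  show ?thesis by (simp add: reg_AstarA_def M_left adj_left)
qed

lemma linear_reg_AstarA:
  assumes A: "Vector_Spaces.linear scale scale A" and nn: "nonneg_op ip A" and c: "0 \<le> \<sigma> * \<tau>"
  shows "Vector_Spaces.linear scale scale (reg_AstarA scale ip \<sigma> \<tau> A)"
  unfolding reg_AstarA_def
  by (intro Vector_Spaces.linear_compose[of scale scale _ scale] A linear_adj linear_inv linear_shift_op bij_shift_op nonneg_op_adj nn c)

lemma reg_AstarA_bound:
  assumes A: "Vector_Spaces.linear scale scale A" and nn: "nonneg_op ip A"
    and "0 \<le> \<sigma> * \<tau>" and r: "r \<le> (\<sigma> * \<tau>)\<^sup>2"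
  shows "0 \<le> ip v v - of_real r * ip (reg_AstarA scale ip \<sigma> \<tau> A v) v"
proof -
  define c where "c = \<sigma> * \<tau>"
  have c: "0 \<le> c" using assms by (simp add: c_def)
  define w where "w = inv (shift_op scale c A) v"
  have v: "v = w + scale (of_real c) (A w)"
    using bij_shift_op[OF A nn c] unfolding w_def
    by (metis bij_is_surj shift_op_def surj_f_inv_f)
  have nnA: "0 \<le> ip (A w) w" using nn by (simp add: nonneg_op_def)
  \<comment> \<open>No symmetry of A is available; the two cross terms of (v, v) agree because (A w,
    w) is a non-negative scalar.\<close>
  have sym: "ip w (A w) = ip (A w) w"
    using conjugate_nonneg[OF nnA] ip_conjugate[of w "A w"] by simp
  have "ip (reg_AstarA scale ip \<sigma> \<tau> A v) v = ip (A w) (A w)"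
    using ip_reg_AstarA[OF A nn, of \<sigma> \<tau>] c by (simp add: w_def c_def)
  then have "ip v v - of_real r * ip (reg_AstarA scale ip \<sigma> \<tau> A v) v =
      ip w w + of_real (2 * c) * ip (A w) w + of_real (c\<^sup>2 - r) * ip (A w) (A w)"
    by (simp only:) (simp add: v ip_simps sym algebra_simps power2_eq_square)
  also have "0 \<le> \<dots>"
    using c r nnA by (intro add_nonneg_nonneg of_real_mult_nonneg ip_self_nonneg) (simp_all add: c_def)
  finally show ?thesis .
qed

section \<open>The regularization of B\<close>

lemma linear_reg_B:
  assumes B: "Vector_Spaces.linear scale scale B" and nn: "nonneg_op ip B" and c: "0 \<le> \<sigma> * \<tau>\<^sup>2"
  shows "Vector_Spaces.linear scale scale (reg_B scale \<sigma> \<tau> B)"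
  unfolding reg_B_def
  by (intro Vector_Spaces.linear_compose[of scale scale _ scale] B linear_inv linear_shift_op bij_shift_op nn c)

text \<open>B commutes with I + d B, hence with its inverse. With the inverse applied first, the
  substitution v = w + d B w removes it altogether.\<close>

lemma reg_B_eq:
  assumes B: "Vector_Spaces.linear scale scale B" and nn: "nonneg_op ip B" and c: "0 \<le> \<sigma> * \<tau>\<^sup>2"
  shows "reg_B scale \<sigma> \<tau> B v = B (inv (shift_op scale (\<sigma> * \<tau>\<^sup>2) B) v)"
proof -
  interpret B: Vector_Spaces.linear scale scale B by fact
  let ?L = "shift_op scale (\<sigma> * \<tau>\<^sup>2) B"
  have bij: "bij ?L" by (rule bij_shift_op[OF B nn c])
  have "B v = B (?L (inv ?L v))" using bij by (simp add: bij_is_surj surj_f_inv_f)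
  also have "\<dots> = ?L (B (inv ?L v))" by (simp add: shift_op_def B.add B.scale)
  finally show ?thesis using bij by (simp add: reg_B_def bij_is_inj inv_f_f)
qed

lemma shift_op_inv_reg_B:
  assumes B: "Vector_Spaces.linear scale scale B" and nn: "nonneg_op ip B" and c: "0 \<le> \<sigma> * \<tau>\<^sup>2"
  obtains w where "v = w + scale (of_real (\<sigma> * \<tau>\<^sup>2)) (B w)" and "reg_B scale \<sigma> \<tau> B v = B w"
proof
  let ?w = "inv (shift_op scale (\<sigma> * \<tau>\<^sup>2) B) v"
  show "v = ?w + scale (of_real (\<sigma> * \<tau>\<^sup>2)) (B ?w)"
    using bij_shift_op[OF B nn c] by (metis bij_is_surj shift_op_def surj_f_inv_f)
  show "reg_B scale \<sigma> \<tau> B v = B ?w" by (rule reg_B_eq[OF assms])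
qed

context
  fixes B :: "'v \<Rightarrow> 'v" and \<sigma> \<tau> :: real
  assumes B: "Vector_Spaces.linear scale scale B" and nn: "nonneg_op ip B"
    and self_adj: "adj ip B = B" and d: "0 \<le> \<sigma> * \<tau>\<^sup>2"
begin

lemma ip_reg_B_commute: "ip (reg_B scale \<sigma> \<tau> B u) v = ip u (reg_B scale \<sigma> \<tau> B v)"
proof -
  obtain x where x: "u = x + scale (of_real (\<sigma> * \<tau>\<^sup>2)) (B x)" "reg_B scale \<sigma> \<tau> B u = B x"
    using shift_op_inv_reg_B[OF B nn d] .
  obtain y where y: "v = y + scale (of_real (\<sigma> * \<tau>\<^sup>2)) (B y)" "reg_B scale \<sigma> \<tau> B v = B y"
    using shift_op_inv_reg_B[OF B nn d] .
  have sym: "ip (B x) y = ip x (B y)" using ip_adj[OF B] self_adj by simp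
  \<comment> \<open>Both sides become (B x, y) + d (B x, B y), where d is
    \<open>\<sigma> * \<tau>\<^sup>2\<close>.\<close>
  show ?thesis unfolding x(2) y(2) unfolding x(1) y(1) by (simp only: ip_simps sym)
qed

lemma nonneg_op_reg_B: "nonneg_op ip (reg_B scale \<sigma> \<tau> B)"
  unfolding nonneg_op_def
proof
  fix v
  obtain w where w: "v = w + scale (of_real (\<sigma> * \<tau>\<^sup>2)) (B w)" "reg_B scale \<sigma> \<tau> B v = B w"
    using shift_op_inv_reg_B[OF B nn d] .
  have "0 \<le> ip (B w) w + of_real (\<sigma> * \<tau>\<^sup>2) * ip (B w) (B w)"
    using nn d by (intro add_nonneg_nonneg of_real_mult_nonneg ip_self_nonneg) (auto simp: nonneg_op_def)
  also have "\<dots> = ip (reg_B scale \<sigma> \<tau> B v) v"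
    unfolding w(2) unfolding w(1) by (simp only: ip_simps)
  finally show "0 \<le> ip (reg_B scale \<sigma> \<tau> B v) v" .
qed

text \<open>The form of the regularized B is (B w, w) + c (B w, B w) with c =
  \<open>\<sigma> * \<tau>\<^sup>2\<close>, against 2 c (B w, w) + c c (B w, B w) in (v, v). The
  second pair of terms forces comparison of r with c, not with its square as for A.\<close>

lemma reg_B_bound:
  assumes r: "r \<le> \<sigma> * \<tau>\<^sup>2"
  shows "0 \<le> ip v v - of_real r * ip (reg_B scale \<sigma> \<tau> B v) v"
proof -
  define c where "c = \<sigma> * \<tau>\<^sup>2"
  have c: "0 \<le> c" "r \<le> c" using d r by (simp_all add: c_def)
  obtain w where w: "v = w + scale (of_real c) (B w)" "reg_B scale \<sigma> \<tau> B v = B w"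
    unfolding c_def using shift_op_inv_reg_B[OF B nn d] .
  have sym: "ip w (B w) = ip (B w) w" using ip_adj[OF B, of w w] self_adj by simp
  have "ip v v - of_real r * ip (reg_B scale \<sigma> \<tau> B v) v =
      ip w w + of_real (2 * c - r) * ip (B w) w + of_real (c * (c - r)) * ip (B w) (B w)"
    unfolding w(2) unfolding w(1) by (simp add: ip_simps sym algebra_simps)
  also have "0 \<le> \<dots>"
    using c nn by (intro add_nonneg_nonneg of_real_mult_nonneg ip_self_nonneg) (auto simp: nonneg_op_def)
  finally show ?thesis .
qed

end

section \<open>Conservation of energy\<close>

text \<open>The D-part of G contributes -1/4 (D(x - y), x - y) and the second term 1/4 (D(x + y), x
  + y); by polarization only the mixed products survive.\<close>

lemma energy_eq:
  assumes D: "Vector_Spaces.linear scale scale D" and \<tau>: "\<tau> \<noteq> 0"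
    and G: "G = (\<lambda>v. v - scale (of_real (\<tau>\<^sup>2 / 4)) (D v))"
  shows "sqnorm_op ip G (scale (of_real (1 / \<tau>)) (x - y)) + sqnorm_op ip D (scale (1 / 2) (x + y)) =
    of_real (1 / \<tau>\<^sup>2) * ip (x - y) (x - y) + (ip (D x) y + ip (D y) x) / 2"
proof -
  interpret D: Vector_Spaces.linear scale scale D by fact
  \<comment> \<open>Seen as the image of a real number, 1/2 is fixed by conjugation.\<close>
  have half: "(1 / 2 :: 'k) = of_real (1 / 2)" by simp
  have \<tau>': "(of_real \<tau> :: 'k) \<noteq> 0" using \<tau> by simp
  show ?thesis
    unfolding sqnorm_op_def G half
    using \<tau>'
    by (simp only: ip_simps D.add D.diff D.scale) (simp add: field_simps power2_eq_square)
qed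

text \<open>By the scheme, x - y is y - z minus \<open>\<tau>\<^sup>2\<close> D y. The resulting
  change of the first term, -(D y, y - z) - (y - z, D y) + \<open>\<tau>\<^sup>2\<close> (D y, D y),
  is cancelled by that of the mixed products.\<close>

lemma energy_step:
  assumes D: "Vector_Spaces.linear scale scale D" and sym: "\<And>u v. ip (D u) v = ip u (D v)"
    and \<tau>: "\<tau> \<noteq> 0"
    and scheme: "scale (of_real (1 / \<tau>\<^sup>2)) (x - scale 2 y + z) + D y = 0"
  shows "of_real (1 / \<tau>\<^sup>2) * ip (x - y) (x - y) + (ip (D x) y + ip (D y) x) / 2 =
    of_real (1 / \<tau>\<^sup>2) * ip (y - z) (y - z) + (ip (D y) z + ip (D z) y) / 2"
proof -
  have "scale (of_real (\<tau>\<^sup>2)) (scale (of_real (1 / \<tau>\<^sup>2)) (x - scale 2 y + z) + D y) = 0"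
    using scheme by simp
  then have "x - scale 2 y + z + scale (of_real (\<tau>\<^sup>2)) (D y) = 0"
    using \<tau> by (simp add: scale_right_distrib)
  moreover have "scale 2 y = y + y" using scale_left_distrib[of 1 1 y] by simp
  ultimately have x: "x = y + y - z - scale (of_real (\<tau>\<^sup>2)) (D y)"
    by (simp add: algebra_simps eq_neg_iff_add_eq_0)
  \<comment> \<open>Symmetry moves every D to the middle level y, so that substituting for x creates
    no second power of D.\<close>
  have Dx: "ip (D x) y = ip x (D y)" and Dz: "ip (D z) y = ip z (D y)" by (rule sym)+
  have Dy: "ip y (D y) = ip (D y) y" by (rule sym[symmetric])
  have \<tau>': "(of_real \<tau> :: 'k) \<noteq> 0" using \<tau> by simp
  show ?thesis unfolding Dx Dz unfolding x using \<tau>'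
    by (simp only: ip_simps Dy) (simp add: field_simps power2_eq_square)
qed

end

theorem theorem3:
  fixes scale :: "'k::hilbert_scalar \<Rightarrow> 'v::ab_group_add \<Rightarrow> 'v"
    and ip :: "'v \<Rightarrow> 'v \<Rightarrow> 'k"
    and A B :: "'v \<Rightarrow> 'v"
    and \<sigma>A \<sigma>B :: real
  assumes "fd_hilbert scale ip"
    and "Vector_Spaces.linear scale scale A"
    and "Vector_Spaces.linear scale scale B"
    and "pos_op ip A"
    and "adj ip B = B" and "nonneg_op ip B"
    and "\<sigma>A > 0" and "\<sigma>B > 0"
    and "\<sigma>A\<^sup>2 \<ge> 1 / 2" and "\<sigma>B \<ge> 1 / 2"
  shows "\<forall>\<tau>::real. \<tau> > 0 \<longrightarrow>
    bij (shift_op scale (\<sigma>A * \<tau>) A) \<and>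
    bij (shift_op scale (\<sigma>A * \<tau>) (adj ip A)) \<and>
    bij (shift_op scale (\<sigma>B * \<tau>\<^sup>2) B) \<and>
    (let AA = reg_AstarA scale ip \<sigma>A \<tau> A;
         BB = reg_B scale \<sigma>B \<tau> B;
         D = (\<lambda>v. AA v + BB v);
         G = (\<lambda>v. v - scale (of_real (\<tau>\<^sup>2 / 4)) (D v))
     in adj ip D = D \<and> nonneg_op ip D \<and>
        adj ip G = G \<and> nonneg_op ip G \<and>
        (\<forall>(N::nat) (w0::'v) (w1::'v) (u :: nat \<Rightarrow> 'v).
           u 0 = w0 \<longrightarrow> u 1 = w1 \<longrightarrow>
           (\<forall>n. 1 \<le> n \<and> n < N \<longrightarrow>
              scale (of_real (1 / \<tau>\<^sup>2)) (u (n + 1) - scale 2 (u n) + u (n - 1))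
                + AA (u n) + BB (u n) = 0) \<longrightarrow>
           (\<forall>n. 1 \<le> n \<and> n < N \<longrightarrow>
              sqnorm_op ip G (scale (of_real (1 / \<tau>)) (u (n + 1) - u n))
                + sqnorm_op ip D (scale (1 / 2) (u (n + 1) + u n))
              = sqnorm_op ip G (scale (of_real (1 / \<tau>)) (w1 - w0))
                + sqnorm_op ip D (scale (1 / 2) (w1 + w0)))))"
proof (intro allI impI, goal_cases)
  case \<tau>: (1 \<tau>)
  interpret fd_hilbert scale ip by fact
  interpret pair: vector_space_pair scale scale ..
  note A = assms(2) and B = assms(3) and self_adj = assms(5) and nnB = assms(6)
  have nnA: "nonneg_op ip A"
    unfolding nonneg_op_def
  proof
    fix u show "0 \<le> ip (A u) u"
      using assms(4) by (cases "u = 0") (auto simp: pos_op_def less_imp_le)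
  qed
  have c: "0 \<le> \<sigma>A * \<tau>" and d: "0 \<le> \<sigma>B * \<tau>\<^sup>2" using assms(7,8) \<tau> by simp_all
  \<comment> \<open>Both sides scale as \<open>\<tau>\<^sup>2\<close>, so the conditions on the two
    weights suffice for every step \<tau>: this is what makes the stability unconditional.\<close>
  have bounds: "\<tau>\<^sup>2 / 2 \<le> (\<sigma>A * \<tau>)\<^sup>2" "\<tau>\<^sup>2 / 2 \<le> \<sigma>B * \<tau>\<^sup>2"
    using mult_right_mono[OF assms(9), of "\<tau>\<^sup>2"] mult_right_mono[OF assms(10), of "\<tau>\<^sup>2"]
    by (simp_all add: power_mult_distrib)
  define AA where "AA = reg_AstarA scale ip \<sigma>A \<tau> A"
  define BB where "BB = reg_B scale \<sigma>B \<tau> B"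
  define D where "D = (\<lambda>v. AA v + BB v)"
  define G where "G = (\<lambda>v. v - scale (of_real (\<tau>\<^sup>2 / 4)) (D v))"
  have D: "Vector_Spaces.linear scale scale D"
    unfolding D_def AA_def BB_def
    by (intro pair.linear_compose_add linear_reg_AstarA linear_reg_B A B nnA nnB c d)
  have "ip (AA u) v = ip u (AA v)" for u v
    unfolding AA_def by (metis ip_reg_AstarA[OF A nnA c] ip_conjugate)
  then have symD: "ip (D u) v = ip u (D v)" for u v
    using ip_reg_B_commute[OF B nnB self_adj d] by (simp add: D_def BB_def ip_simps)
  have "adj ip D = D" by (rule adj_eqI) (rule symD)
  moreover have "nonneg_op ip D"
    using ip_reg_AstarA[OF A nnA c] ip_self_nonneg nonneg_op_reg_B[OF B nnB self_adj d]
    by (simp add: nonneg_op_def D_def AA_def BB_def ip_add_left)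
  moreover have "adj ip G = G"
    by (rule adj_eqI) (simp only: G_def ip_simps symD)
  moreover have "nonneg_op ip G"
    unfolding nonneg_op_def
  proof
    fix v
    \<comment> \<open>One half of I is assigned to each operator, which turns the factor
      \<open>\<tau>\<^sup>2 / 4\<close> of G into r = \<open>\<tau>\<^sup>2 / 2\<close> in the two
      bounds.\<close>
    have "0 \<le> of_real (1 / 2) * (ip v v - of_real (\<tau>\<^sup>2 / 2) * ip (AA v) v) +
        of_real (1 / 2) * (ip v v - of_real (\<tau>\<^sup>2 / 2) * ip (BB v) v)"
      unfolding AA_def BB_def using bounds
      by (intro add_nonneg_nonneg of_real_mult_nonneg reg_AstarA_bound A nnA c
          reg_B_bound B nnB self_adj d) simp_all
    also have "\<dots> = ip (G v) v"
      by (simp add: G_def D_def ip_simps field_simps)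
    finally show "0 \<le> ip (G v) v" .
  qed
  moreover have "sqnorm_op ip G (scale (of_real (1 / \<tau>)) (u (n + 1) - u n))
      + sqnorm_op ip D (scale (1 / 2) (u (n + 1) + u n))
      = sqnorm_op ip G (scale (of_real (1 / \<tau>)) (u 1 - u 0))
      + sqnorm_op ip D (scale (1 / 2) (u 1 + u 0))"
    if scheme: "\<forall>n. 1 \<le> n \<and> n < N \<longrightarrow>
      scale (of_real (1 / \<tau>\<^sup>2)) (u (n + 1) - scale 2 (u n) + u (n - 1)) + AA (u n) + BB (u n) = 0"
      and "n < N" for N n :: nat and u :: "nat \<Rightarrow> 'v"
    using \<open>n < N\<close>
  \<comment> \<open>The induction starts at n = 0, where both sides coincide; the passage from n to
    \<open>Suc n\<close> uses the scheme at level \<open>Suc n\<close>, which lies between 1 and N -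
    1.\<close>
  proof (induction n)
    case (Suc n)
    have \<tau>0: "\<tau> \<noteq> 0" using \<tau> by simp
    have "scale (of_real (1 / \<tau>\<^sup>2)) (u (Suc n + 1) - scale 2 (u (Suc n)) + u n) + D (u (Suc n)) = 0"
      using scheme[rule_format, of "Suc n"] Suc.prems by (simp add: D_def add.assoc)
    then have "sqnorm_op ip G (scale (of_real (1 / \<tau>)) (u (Suc n + 1) - u (Suc n)))
        + sqnorm_op ip D (scale (1 / 2) (u (Suc n + 1) + u (Suc n)))
        = sqnorm_op ip G (scale (of_real (1 / \<tau>)) (u (Suc n) - u n))
        + sqnorm_op ip D (scale (1 / 2) (u (Suc n) + u n))"
      unfolding energy_eq[OF D \<tau>0 G_def] by (rule energy_step[OF D symD \<tau>0])
    with Suc show ?case by simp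
  qed simp
  moreover have "bij (shift_op scale (\<sigma>A * \<tau>) A)" "bij (shift_op scale (\<sigma>A * \<tau>) (adj ip A))"
      "bij (shift_op scale (\<sigma>B * \<tau>\<^sup>2) B)"
    by (intro bij_shift_op linear_adj nonneg_op_adj A B nnA nnB c d)+
  ultimately show ?case
    unfolding Let_def AA_def[symmetric] BB_def[symmetric] D_def[symmetric] G_def[unfolded D_def, symmetric]
    by blast
qed

end
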